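(* In the limit $R\to\infty$ keeping $r_k=R\theta_k$ (and $\dot r_k=R\dot\theta_k$, $\phi_k$, $\dot\phi_k$) fixed, the angular momentum integrals $(c_x,c_y,c_z)$ of the $n$-body problem on the sphere of radius $R$ go to the integrals on the Euclidean plane, namely $$\frac{1}{R}(c_x,c_y)\to(-p_y,p_x)\qquad\text{and}\qquad c_z\to C_z .$$
   Context: On the sphere of radius $R$ with spherical coordinates $(X,Y,Z)=R(\sin\theta\cos\phi,\sin\theta\sin\phi,\cos\theta)$, masses $m_k>0$ at $(\theta_k,\phi_k)$ have angular momentum components $$c_x=R^2\sum_k m_k(-\sin(\phi_k)\dot\theta_k-\sin(\theta_k)\cos(\theta_k)\cos(\phi_k)\dot\phi_k),$$ $$c_y=R^2\sum_k m_k(\cos(\phi_k)\dot\theta_k-\sin(\theta_k)\cos(\theta_k)\sin(\phi_k)\dot\phi_k),\qquad c_z=R^2\sum_k m_k\sin^2(\theta_k)\dot\phi_k .$$ On the Euclidean plane (the tangent plane at the north pole), with polar coordinates $(r_k,\phi_k)$ and $(x_k,y_k)=(r_k\cos\phi_k,r_k\sin\phi_k)$, the linear momentum is $(p_x,p_y)=\sum_k m_k(\dot x_k,\dot y_k)$ and the angular momentum is $C_z=\sum_k m_kr_k^2\dot\phi_k$. *)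

theory Defs
  imports "HOL-Analysis.Analysis"
begin

text \<open>
  Bodies are numbered \<open>1, \<dots>, n\<close>. A motion is given by its coordinate functions of time, so
  \<open>\<theta> k t\<close>, \<open>\<phi> k t\<close> and \<open>r k t\<close> are the coordinates of body \<open>k\<close> at time \<open>t\<close>, and a dot
  is \<^const>\<open>deriv\<close> with respect to \<open>t\<close>.

  Angular momentum on the sphere of radius \<open>R\<close> in \<open>\<real>\<^sup>3\<close>, in the spherical coordinates
  \<open>R (sin \<theta> cos \<phi>, sin \<theta> sin \<phi>, cos \<theta>)\<close>; \<open>\<theta>\<close> is the polar angle measured from the north pole.
\<close>

definition sphere_c_x ::
  "nat \<Rightarrow> (nat \<Rightarrow> real) \<Rightarrow> real \<Rightarrow> (nat \<Rightarrow> real \<Rightarrow> real) \<Rightarrow> (nat \<Rightarrow> real \<Rightarrow> real) \<Rightarrow> real \<Rightarrow> real"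
  where "sphere_c_x n m R \<theta> \<phi> t =
    R\<^sup>2 * (\<Sum>k=1..n. m k *
      (- sin (\<phi> k t) * deriv (\<theta> k) t
       - sin (\<theta> k t) * cos (\<theta> k t) * cos (\<phi> k t) * deriv (\<phi> k) t))"

definition sphere_c_y ::
  "nat \<Rightarrow> (nat \<Rightarrow> real) \<Rightarrow> real \<Rightarrow> (nat \<Rightarrow> real \<Rightarrow> real) \<Rightarrow> (nat \<Rightarrow> real \<Rightarrow> real) \<Rightarrow> real \<Rightarrow> real"
  where "sphere_c_y n m R \<theta> \<phi> t =
    R\<^sup>2 * (\<Sum>k=1..n. m k *
      (cos (\<phi> k t) * deriv (\<theta> k) t
       - sin (\<theta> k t) * cos (\<theta> k t) * sin (\<phi> k t) * deriv (\<phi> k) t))"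

definition sphere_c_z ::
  "nat \<Rightarrow> (nat \<Rightarrow> real) \<Rightarrow> real \<Rightarrow> (nat \<Rightarrow> real \<Rightarrow> real) \<Rightarrow> (nat \<Rightarrow> real \<Rightarrow> real) \<Rightarrow> real \<Rightarrow> real"
  where "sphere_c_z n m R \<theta> \<phi> t =
    R\<^sup>2 * (\<Sum>k=1..n. m k * (sin (\<theta> k t))\<^sup>2 * deriv (\<phi> k) t)"

text \<open>
  Momenta on the Euclidean plane in polar coordinates. The linear momentum is the
  mass-weighted sum of the time derivatives of the Cartesian coordinates.
\<close>

definition plane_x :: "(nat \<Rightarrow> real \<Rightarrow> real) \<Rightarrow> (nat \<Rightarrow> real \<Rightarrow> real) \<Rightarrow> nat \<Rightarrow> real \<Rightarrow> real"
  where "plane_x r \<phi> k t = r k t * cos (\<phi> k t)"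

definition plane_y :: "(nat \<Rightarrow> real \<Rightarrow> real) \<Rightarrow> (nat \<Rightarrow> real \<Rightarrow> real) \<Rightarrow> nat \<Rightarrow> real \<Rightarrow> real"
  where "plane_y r \<phi> k t = r k t * sin (\<phi> k t)"

definition plane_p_x ::
  "nat \<Rightarrow> (nat \<Rightarrow> real) \<Rightarrow> (nat \<Rightarrow> real \<Rightarrow> real) \<Rightarrow> (nat \<Rightarrow> real \<Rightarrow> real) \<Rightarrow> real \<Rightarrow> real"
  where "plane_p_x n m r \<phi> t = (\<Sum>k=1..n. m k * deriv (plane_x r \<phi> k) t)"

definition plane_p_y ::
  "nat \<Rightarrow> (nat \<Rightarrow> real) \<Rightarrow> (nat \<Rightarrow> real \<Rightarrow> real) \<Rightarrow> (nat \<Rightarrow> real \<Rightarrow> real) \<Rightarrow> real \<Rightarrow> real"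
  where "plane_p_y n m r \<phi> t = (\<Sum>k=1..n. m k * deriv (plane_y r \<phi> k) t)"

definition plane_C_z ::
  "nat \<Rightarrow> (nat \<Rightarrow> real) \<Rightarrow> (nat \<Rightarrow> real \<Rightarrow> real) \<Rightarrow> (nat \<Rightarrow> real \<Rightarrow> real) \<Rightarrow> real \<Rightarrow> real"
  where "plane_C_z n m r \<phi> t = (\<Sum>k=1..n. m k * (r k t)\<^sup>2 * deriv (\<phi> k) t)"

end

theory Submission
  imports Defs "HOL-Real_Asymp.Real_Asymp"
begin

text \<open>
  Write \<open>\<rho> = r k t\<close> for the planar radius of a body and \<open>\<theta> = \<rho> / R\<close> for its polar angle. The whole
  argument is that the sphere flattens out: \<open>R * sin (\<rho> / R) \<longlongrightarrow> \<rho>\<close> and \<open>cos (\<rho> / R) \<longlongrightarrow> 1\<close>, since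
  \<open>sin x\<close> is \<open>x\<close> to first order (\<open>scaled_sin_tendsto\<close>, \<open>scaled_sin_cos_tendsto\<close>).

  The powers of \<open>R\<close> in the momenta are exactly those that this limit absorbs. In \<open>c\<^sub>x / R\<close> and
  \<open>c\<^sub>y / R\<close> one factor \<open>R\<close> is left; it turns \<open>deriv \<theta>\<close> into \<open>deriv r\<close>, which does not depend on \<open>R\<close>,
  and \<open>sin \<theta> * cos \<theta>\<close> into a quantity that tends to \<open>\<rho>\<close>. In \<open>c\<^sub>z\<close> the factor \<open>R\<^sup>2\<close> turns \<open>(sin \<theta>)\<^sup>2\<close>
  into a quantity that tends to \<open>\<rho>\<^sup>2\<close>. For each body, the limits of its terms in \<open>c\<^sub>x / R\<close> and
  \<open>c\<^sub>y / R\<close> are, by the product rule, \<open>m\<close> times \<open>- y'\<close> and \<open>x'\<close> written in polar coordinates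
  (\<open>deriv_plane_x\<close>, \<open>deriv_plane_y\<close>).
\<close>

lemma scaled_sin_tendsto: "((\<lambda>R. R * sin (\<rho> / R)) \<longlongrightarrow> \<rho>) at_top" for \<rho> :: real
  by real_asymp

lemma scaled_sin_cos_tendsto:
  "((\<lambda>R. R * (sin (\<rho> / R) * cos (\<rho> / R))) \<longlongrightarrow> \<rho>) at_top" for \<rho> :: real
proof -
  have "((\<lambda>R. cos (\<rho> / R)) \<longlongrightarrow> 1) at_top"
    by real_asymp
  from tendsto_mult[OF scaled_sin_tendsto this] show ?thesis
    by (simp add: mult.assoc)
qed

lemma deriv_plane_x:
  assumes "r k differentiable at t" and "\<phi> k differentiable at t"
  shows "deriv (plane_x r \<phi> k) t
    = cos (\<phi> k t) * deriv (r k) t - r k t * sin (\<phi> k t) * deriv (\<phi> k) t"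
proof -
  have [derivative_intros]: "(r k has_real_derivative deriv (r k) t) (at t)"
      "(\<phi> k has_real_derivative deriv (\<phi> k) t) (at t)"
    using assms by (simp_all add: DERIV_deriv_iff_real_differentiable)
  show ?thesis
    unfolding plane_x_def by (rule DERIV_imp_deriv) (auto intro!: derivative_eq_intros)
qed

lemma deriv_plane_y:
  assumes "r k differentiable at t" and "\<phi> k differentiable at t"
  shows "deriv (plane_y r \<phi> k) t
    = sin (\<phi> k t) * deriv (r k) t + r k t * cos (\<phi> k t) * deriv (\<phi> k) t"
proof -
  have [derivative_intros]: "(r k has_real_derivative deriv (r k) t) (at t)"
      "(\<phi> k has_real_derivative deriv (\<phi> k) t) (at t)"
    using assms by (simp_all add: DERIV_deriv_iff_real_differentiable)
  show ?thesis
    unfolding plane_y_def by (rule DERIV_imp_deriv) (auto intro!: derivative_eq_intros)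
qed

theorem proposition1:
  fixes n :: nat and m :: "nat \<Rightarrow> real"
    and r \<phi> :: "nat \<Rightarrow> real \<Rightarrow> real"
    and \<theta> :: "real \<Rightarrow> nat \<Rightarrow> real \<Rightarrow> real"
    and t :: real
  assumes "\<And>k. k \<in> {1..n} \<Longrightarrow> m k > 0"
    and "\<And>k. k \<in> {1..n} \<Longrightarrow> r k differentiable at t"
    and "\<And>k. k \<in> {1..n} \<Longrightarrow> \<phi> k differentiable at t"
    and "\<And>R k. R > 0 \<Longrightarrow> k \<in> {1..n} \<Longrightarrow> \<theta> R k differentiable at t"
    and "\<And>R k. R > 0 \<Longrightarrow> k \<in> {1..n} \<Longrightarrow> r k t = R * \<theta> R k t"
    and "\<And>R k. R > 0 \<Longrightarrow> k \<in> {1..n} \<Longrightarrow> deriv (r k) t = R * deriv (\<theta> R k) t"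
  shows "((\<lambda>R. (1 / R) *\<^sub>R (sphere_c_x n m R (\<theta> R) \<phi> t, sphere_c_y n m R (\<theta> R) \<phi> t))
            \<longlongrightarrow> (- plane_p_y n m r \<phi> t, plane_p_x n m r \<phi> t)) at_top
         \<and> ((\<lambda>R. sphere_c_z n m R (\<theta> R) \<phi> t) \<longlongrightarrow> plane_C_z n m r \<phi> t) at_top"
proof
  let ?I = "{1..n}"
  have angle: "\<theta> R k t = r k t / R" and speed: "deriv (\<theta> R k) t = deriv (r k) t / R"
    if "R > 0" "k \<in> ?I" for R k
    using assms(5)[OF that] assms(6)[OF that] that(1) by simp_all

  have "((\<lambda>R. \<Sum>k\<in>?I. m k * (- sin (\<phi> k t) * deriv (r k) t
            - R * (sin (r k t / R) * cos (r k t / R)) * cos (\<phi> k t) * deriv (\<phi> k) t))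
          \<longlongrightarrow> (\<Sum>k\<in>?I. m k * (- sin (\<phi> k t) * deriv (r k) t
            - r k t * cos (\<phi> k t) * deriv (\<phi> k) t))) at_top"
    by (intro tendsto_intros scaled_sin_cos_tendsto)
  also have "(\<Sum>k\<in>?I. m k * (- sin (\<phi> k t) * deriv (r k) t
            - r k t * cos (\<phi> k t) * deriv (\<phi> k) t)) = - plane_p_y n m r \<phi> t"
    unfolding plane_p_y_def sum_negf[symmetric]
    by (rule sum.cong) (simp_all add: deriv_plane_y assms(2,3) algebra_simps)
  finally have lim_x: "((\<lambda>R. sphere_c_x n m R (\<theta> R) \<phi> t / R) \<longlongrightarrow> - plane_p_y n m r \<phi> t) at_top"
  proof (rule Lim_transform_eventually)
    show "\<forall>\<^sub>F R in at_top. (\<Sum>k\<in>?I. m k * (- sin (\<phi> k t) * deriv (r k) t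
            - R * (sin (r k t / R) * cos (r k t / R)) * cos (\<phi> k t) * deriv (\<phi> k) t))
          = sphere_c_x n m R (\<theta> R) \<phi> t / R"
      using eventually_gt_at_top[of "0 :: real"]
    proof eventually_elim
      case (elim R)
      then show ?case
        unfolding sphere_c_x_def sum_distrib_left sum_divide_distrib
        by (intro sum.cong) (simp_all add: angle speed field_simps power2_eq_square)
    qed
  qed

  have "((\<lambda>R. \<Sum>k\<in>?I. m k * (cos (\<phi> k t) * deriv (r k) t
            - R * (sin (r k t / R) * cos (r k t / R)) * sin (\<phi> k t) * deriv (\<phi> k) t))
          \<longlongrightarrow> (\<Sum>k\<in>?I. m k * (cos (\<phi> k t) * deriv (r k) t
            - r k t * sin (\<phi> k t) * deriv (\<phi> k) t))) at_top"
    by (intro tendsto_intros scaled_sin_cos_tendsto)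
  also have "(\<Sum>k\<in>?I. m k * (cos (\<phi> k t) * deriv (r k) t
            - r k t * sin (\<phi> k t) * deriv (\<phi> k) t)) = plane_p_x n m r \<phi> t"
    unfolding plane_p_x_def
    by (rule sum.cong) (simp_all add: deriv_plane_x assms(2,3))
  finally have lim_y: "((\<lambda>R. sphere_c_y n m R (\<theta> R) \<phi> t / R) \<longlongrightarrow> plane_p_x n m r \<phi> t) at_top"
  proof (rule Lim_transform_eventually)
    show "\<forall>\<^sub>F R in at_top. (\<Sum>k\<in>?I. m k * (cos (\<phi> k t) * deriv (r k) t
            - R * (sin (r k t / R) * cos (r k t / R)) * sin (\<phi> k t) * deriv (\<phi> k) t))
          = sphere_c_y n m R (\<theta> R) \<phi> t / R"
      using eventually_gt_at_top[of "0 :: real"]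
    proof eventually_elim
      case (elim R)
      then show ?case
        unfolding sphere_c_y_def sum_distrib_left sum_divide_distrib
        by (intro sum.cong) (simp_all add: angle speed field_simps power2_eq_square)
    qed
  qed

  show "((\<lambda>R. (1 / R) *\<^sub>R (sphere_c_x n m R (\<theta> R) \<phi> t, sphere_c_y n m R (\<theta> R) \<phi> t))
            \<longlongrightarrow> (- plane_p_y n m r \<phi> t, plane_p_x n m r \<phi> t)) at_top"
    using tendsto_Pair[OF lim_x lim_y] by (simp add: scaleR_Pair)

  have "((\<lambda>R. \<Sum>k\<in>?I. m k * (R * sin (r k t / R))\<^sup>2 * deriv (\<phi> k) t)
          \<longlongrightarrow> plane_C_z n m r \<phi> t) at_top"
    unfolding plane_C_z_def by (intro tendsto_intros scaled_sin_tendsto)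
  then show "((\<lambda>R. sphere_c_z n m R (\<theta> R) \<phi> t) \<longlongrightarrow> plane_C_z n m r \<phi> t) at_top"
  proof (rule Lim_transform_eventually)
    show "\<forall>\<^sub>F R in at_top. (\<Sum>k\<in>?I. m k * (R * sin (r k t / R))\<^sup>2 * deriv (\<phi> k) t)
          = sphere_c_z n m R (\<theta> R) \<phi> t"
      using eventually_gt_at_top[of "0 :: real"]
    proof eventually_elim
      case (elim R)
      then show ?case
        unfolding sphere_c_z_def sum_distrib_left
        by (intro sum.cong) (simp_all add: angle power_mult_distrib)
    qed
  qed
qed

end
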